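(* Let $x$ be a positive integer, and let $T(x)$ be the number of integers $a$ with $1\le a\le x$ such that both $a-1$ and $a+1$ are relatively prime to $x$. Then $$T(x) = x\cdot \frac{\prod_{p\mid x,\ p\neq 2}(p-2)}{\prod_{p\mid x}p},$$ where the products run over the distinct prime divisors $p$ of $x$ (the numerator omitting the prime $2$), and empty products equal $1$.
   Context: The convention $\gcd(0,x)=x$ is used, so $0$ is relatively prime to $x$ only when $x=1$. *)

theory Defs
  imports Complex_Main "HOL-Computational_Algebra.Primes"
begin

definition T :: "int \<Rightarrow> nat" where
  "T x = card {a \<in> {1..x}. coprime (a - 1) x \<and> coprime (a + 1) x}"

end

theory Submission
  imports Defs
begin

text \<open>
  An integer \<open>a\<close> is counted iff no prime divisor \<open>p\<close> of \<open>x\<close> divides \<open>a - 1\<close> or \<open>a + 1\<close>, that is,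
  iff \<open>a\<close> avoids the residues \<open>1\<close> and \<open>-1\<close> modulo every such \<open>p\<close>.  These two residues coincide for
  \<open>p = 2\<close> and are distinct otherwise, so there are \<open>1\<close>, respectively \<open>p - 2\<close>, admissible residues
  modulo \<open>p\<close> (\<open>card_residues_avoiding_pm1\<close>).  By the Chinese remainder theorem
  (\<open>card_periodic_coprime\<close>) the conditions at different primes are independent, so over one period of
  length \<open>m = \<Prod>p\<close> the count is the product of the local counts.  Finally, \<open>{1..x}\<close> consists of
  \<open>x / m\<close> full periods (\<open>card_periodic_multiple\<close>).
\<close>

text \<open>
  The map sending \<open>a\<close> to \<open>(a mod m, a mod n)\<close> is injective on \<open>{0..<m * n}\<close> because \<open>m\<close> and \<open>n\<close> are
  coprime, hence bijective onto the pairs of residues by counting; it splits the two conditions.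
\<close>
lemma card_periodic_coprime:
  fixes m n :: int
  assumes "m > 0" "n > 0" "coprime m n"
    and A: "\<And>a. A (a mod m) \<longleftrightarrow> A a" and B: "\<And>a. B (a mod n) \<longleftrightarrow> B a"
  shows "card {a\<in>{0..<m * n}. A a \<and> B a} = card {a\<in>{0..<m}. A a} * card {a\<in>{0..<n}. B a}"
proof -
  define f where "f = (\<lambda>a. (a mod m, a mod n))"
  have inj: "inj_on f {0..<m * n}"
  proof (rule inj_onI)
    fix a b assume ab: "a \<in> {0..<m * n}" "b \<in> {0..<m * n}" and "f a = f b"
    then have "m dvd a - b" "n dvd a - b"
      by (auto simp: f_def mod_eq_dvd_iff)
    then have "m * n dvd a - b"
      using \<open>coprime m n\<close> by (simp add: divides_mult)
    then have "a mod (m * n) = b mod (m * n)"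
      by (simp add: mod_eq_dvd_iff)
    then show "a = b" using ab by simp
  qed
  have "f ` {0..<m * n} = {0..<m} \<times> {0..<n}"
  proof (rule card_subset_eq)
    show "f ` {0..<m * n} \<subseteq> {0..<m} \<times> {0..<n}"
      using assms(1,2) by (auto simp: f_def)
    show "card (f ` {0..<m * n}) = card ({0..<m} \<times> {0..<n})"
      using assms(1,2) by (simp add: card_image[OF inj] card_cartesian_product nat_mult_distrib)
  qed simp
  moreover have "A a \<and> B a \<longleftrightarrow> f a \<in> {a. A a} \<times> {a. B a}" for a
    by (simp add: f_def A B)
  then have "{a\<in>{0..<m * n}. A a \<and> B a} = {0..<m * n} \<inter> f -` ({a. A a} \<times> {a. B a})"
    by auto
  moreover have "f ` (S \<inter> f -` R) = f ` S \<inter> R" for S R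
    by auto
  ultimately have "f ` {a\<in>{0..<m * n}. A a \<and> B a} = ({0..<m} \<times> {0..<n}) \<inter> ({a. A a} \<times> {a. B a})"
    by simp
  then have "f ` {a\<in>{0..<m * n}. A a \<and> B a} = {a\<in>{0..<m}. A a} \<times> {a\<in>{0..<n}. B a}"
    by auto
  moreover have "inj_on f {a\<in>{0..<m * n}. A a \<and> B a}"
    using inj by (rule inj_on_subset) auto
  ultimately show ?thesis
    using card_image[of f "{a\<in>{0..<m * n}. A a \<and> B a}"] by (simp add: card_cartesian_product)
qed

lemma card_periodic_multiple:
  fixes m k :: int
  assumes "m > 0" "k \<ge> 0" and A: "\<And>a. A (a mod m) \<longleftrightarrow> A a"
  shows "card {a\<in>{0..<m * k}. A a} = card {a\<in>{0..<m}. A a} * nat k"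
proof -
  have "bij_betw (\<lambda>a. (a mod m, a div m)) {a\<in>{0..<m * k}. A a} ({a\<in>{0..<m}. A a} \<times> {0..<k})"
  proof (rule bij_betw_byWitness[where f' = "\<lambda>(r, q). r + m * q"])
    have "r + m * q < m * k" if "r < m" "q < k" for r q :: int
    proof -
      have "r + m * q < m * (q + 1)" using that by (simp add: algebra_simps)
      also have "\<dots> \<le> m * k" using that \<open>m > 0\<close> by (intro mult_left_mono) auto
      finally show ?thesis .
    qed
    moreover have "A (r + m * q) \<longleftrightarrow> A r" for r q
      using A[of "r + m * q"] A[of r] by simp
    ultimately show "(\<lambda>(r, q). r + m * q) ` ({a\<in>{0..<m}. A a} \<times> {0..<k})
        \<subseteq> {a\<in>{0..<m * k}. A a}"
      using \<open>m > 0\<close> by auto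
    have "a div m < k" if "a < m * k" for a
    proof -
      have "m * (a div m) \<le> a"
        using \<open>m > 0\<close> by (simp flip: minus_mod_eq_mult_div)
      then have "m * (a div m) < m * k" using that by simp
      then show ?thesis using \<open>m > 0\<close> by simp
    qed
    then show "(\<lambda>a. (a mod m, a div m)) ` {a\<in>{0..<m * k}. A a} \<subseteq> {a\<in>{0..<m}. A a} \<times> {0..<k}"
      using \<open>m > 0\<close> by (auto simp: A pos_imp_zdiv_nonneg_iff)
  qed (use \<open>m > 0\<close> in auto)
  then show ?thesis
    by (simp add: bij_betw_same_card card_cartesian_product)
qed

text \<open>
  The excluded residues are \<open>1\<close> and \<open>p - 1\<close>, which are one and the same exactly when \<open>p = 2\<close>.
\<close>
lemma card_residues_avoiding_pm1:
  fixes p :: int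
  assumes "p \<ge> 2"
  shows "card {a\<in>{0..<p}. \<not> p dvd a - 1 \<and> \<not> p dvd a + 1} = (if p = 2 then 1 else nat (p - 2))"
proof -
  have minus: "p dvd a - 1 \<longleftrightarrow> a = 1" if "a \<in> {0..<p}" for a
    using that assms mod_eq_dvd_iff[of a p 1] by simp
  have plus: "p dvd a + 1 \<longleftrightarrow> a = p - 1" if "a \<in> {0..<p}" for a
    using that assms zdvd_imp_le[of p "a + 1"] by auto
  have "{a\<in>{0..<p}. \<not> p dvd a - 1 \<and> \<not> p dvd a + 1} = {0..<p} - {1, p - 1}"
    using minus plus by blast
  moreover have "card ({0..<p} - {1, p - 1}) = card {0..<p} - card {1, p - 1}"
    using assms by (intro card_Diff_subset) auto
  moreover have "card {1, p - 1} = (if p = 2 then 1 else 2)"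
    by (simp add: card_insert_if)
  ultimately show ?thesis
    using assms by (simp add: nat_diff_distrib)
qed

lemma dvd_mod_add_iff:
  fixes p m a c :: int
  assumes "p dvd m"
  shows "p dvd a mod m + c \<longleftrightarrow> p dvd a + c"
  using dvd_mod_iff[OF assms, of "a mod m + c"] dvd_mod_iff[OF assms, of "a + c"]
  by (simp add: mod_add_left_eq)

lemma card_avoiding_pm1_prod:
  fixes P :: "int set"
  assumes "finite P" "\<And>p. p \<in> P \<Longrightarrow> prime p"
  shows "card {a\<in>{0..<\<Prod>P}. \<forall>p\<in>P. \<not> p dvd a - 1 \<and> \<not> p dvd a + 1} =
    (\<Prod>p\<in>P - {2}. nat (p - 2))"
  using assms
proof (induction P rule: finite_induct)
  case empty
  have "{a::int. a = 0} = {0}" by auto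
  moreover have "{0..<1::int} = {0}" by auto
  ultimately show ?case by simp
next
  case (insert q P)
  have q: "prime q" and P: "\<And>p. p \<in> P \<Longrightarrow> prime p"
    using insert.prems by auto
  let ?good = "\<lambda>p a. \<not> p dvd a - 1 \<and> \<not> p dvd a + 1"
  have good_mod: "?good p (a mod m) \<longleftrightarrow> ?good p a" if "p dvd m" for p m a :: int
    using dvd_mod_add_iff[OF that, of a 1] dvd_mod_add_iff[OF that, of a "-1"] by simp
  have "coprime q (\<Prod>P)"
    using insert.hyps P q by (intro prod_coprime_right) (metis primes_coprime)
  moreover have "\<Prod>P > 0"
    using P by (intro prod_pos) (simp add: prime_gt_0_int)
  moreover have "p dvd \<Prod>P" if "p \<in> P" for p
    using dvd_prodI[OF \<open>finite P\<close> that, of "\<lambda>p. p"] by simp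
  ultimately have "card {a\<in>{0..<q * \<Prod>P}. ?good q a \<and> (\<forall>p\<in>P. ?good p a)} =
      card {a\<in>{0..<q}. ?good q a} * card {a\<in>{0..<\<Prod>P}. \<forall>p\<in>P. ?good p a}"
    using q good_mod by (intro card_periodic_coprime ball_cong refl) (auto simp: prime_gt_0_int)
  then have "card {a\<in>{0..<\<Prod>(insert q P)}. \<forall>p\<in>insert q P. ?good p a} =
      (if q = 2 then 1 else nat (q - 2)) * (\<Prod>p\<in>P - {2}. nat (p - 2))"
    using insert.IH[OF P] insert.hyps card_residues_avoiding_pm1[OF prime_ge_2_int[OF q]]
    by simp
  also have "\<dots> = (\<Prod>p\<in>insert q P - {2}. nat (p - 2))"
    using insert.hyps by (auto simp: insert_Diff_if)
  finally show ?case .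
qed

lemma coprime_iff_prime_factors_not_dvd:
  fixes a x :: int
  assumes "x \<noteq> 0"
  shows "coprime a x \<longleftrightarrow> (\<forall>p\<in>prime_factors x. \<not> p dvd a)"
proof
  assume "coprime a x"
  then show "\<forall>p\<in>prime_factors x. \<not> p dvd a"
    by (metis coprime_common_divisor in_prime_factors_iff not_prime_unit)
next
  assume R: "\<forall>p\<in>prime_factors x. \<not> p dvd a"
  show "coprime a x"
  proof (rule ccontr)
    assume "\<not> coprime a x"
    then obtain p where "prime p" "p dvd gcd a x"
      using prime_divisorE[of "gcd a x"] assms by (auto simp: coprime_iff_gcd_eq_1)
    then show False using R assms by (auto simp: in_prime_factors_iff)
  qed
qed

theorem mainTheorem3:
  fixes x :: int
  assumes "x > 0"
  shows "real (T x) =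
    real_of_int x * ((\<Prod>p\<in>prime_factors x - {2}. real_of_int (p - 2))
                     / (\<Prod>p\<in>prime_factors x. real_of_int p))"
proof -
  define P where "P = prime_factors x"
  define m where "m = \<Prod>P"
  define good where "good = (\<lambda>a::int. \<forall>p\<in>P. \<not> p dvd a - 1 \<and> \<not> p dvd a + 1)"
  have P: "finite P" "\<And>p. p \<in> P \<Longrightarrow> prime p"
    by (auto simp: P_def in_prime_factors_iff)
  have "m > 0"
    unfolding m_def using P by (intro prod_pos) (simp add: prime_gt_0_int)
  have "m dvd (\<Prod>p\<in>P. p ^ multiplicity p x)"
    unfolding m_def P_def
    by (intro prod_dvd_prod dvd_power) (simp add: prime_factors_multiplicity)
  then have "m dvd x"
    using assms by (simp add: P_def prod_prime_factors)
  then obtain k where k: "x = m * k" ..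
  then have "k > 0"
    using assms \<open>m > 0\<close> by (simp add: zero_less_mult_iff)
  have good_mod: "good (a mod n) \<longleftrightarrow> good a" if "m dvd n" for a n
  proof -
    have "p dvd n" if "p \<in> P" for p
      using dvd_prodI[OF P(1) that, of "\<lambda>p. p"] \<open>m dvd n\<close> dvd_trans by (auto simp: m_def)
    then show ?thesis
      unfolding good_def using dvd_mod_add_iff[of _ n a 1] dvd_mod_add_iff[of _ n a "-1"]
      by (intro ball_cong refl) simp
  qed
  have "{a\<in>{1..x}. coprime (a - 1) x \<and> coprime (a + 1) x} = {a\<in>{1..x}. good a}"
    using assms by (auto simp: good_def P_def coprime_iff_prime_factors_not_dvd)
  then have "T x = card {a\<in>{1..x}. good a}"
    by (simp add: T_def)
  \<comment> \<open>Shift the interval to the standard residues: \<open>x\<close> and \<open>0\<close> are congruent modulo \<open>x\<close>.\<close>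
  also have "\<dots> = card {a\<in>{0..<x}. good a}"
  proof (rule bij_betw_same_card, rule bij_betw_byWitness[where f' = "\<lambda>a. if a = 0 then x else a"])
    have "good x \<longleftrightarrow> good 0"
      using good_mod[OF \<open>m dvd x\<close>, of x] by simp
    then show "(\<lambda>a. if a = x then 0 else a) ` {a\<in>{1..x}. good a} \<subseteq> {a\<in>{0..<x}. good a}"
      and "(\<lambda>a. if a = 0 then x else a) ` {a\<in>{0..<x}. good a} \<subseteq> {a\<in>{1..x}. good a}"
      using assms by auto
  qed auto
  also have "\<dots> = card {a\<in>{0..<m}. good a} * nat k"
    unfolding k using \<open>m > 0\<close> \<open>k > 0\<close> good_mod by (intro card_periodic_multiple) auto
  also have "card {a\<in>{0..<m}. good a} = (\<Prod>p\<in>P - {2}. nat (p - 2))"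
    unfolding m_def good_def using P by (rule card_avoiding_pm1_prod)
  finally have "real (T x) = (\<Prod>p\<in>P - {2}. real (nat (p - 2))) * real_of_int k"
    using \<open>k > 0\<close> by simp
  also have "(\<Prod>p\<in>P - {2}. real (nat (p - 2))) = (\<Prod>p\<in>P - {2}. real_of_int (p - 2))"
    using P(2) prime_ge_2_int by (intro prod.cong) auto
  also have "real_of_int k = real_of_int x / (\<Prod>p\<in>P. real_of_int p)"
    using \<open>m > 0\<close> by (simp add: k m_def flip: of_int_prod)
  finally show ?thesis
    by (simp add: P_def mult.commute)
qed

end
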